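(* Fix $b\in\mathscr{S}(n)$ and $\alpha\in\mathcal{U}(n)$. Then for every $\lambda\in\mathbb{T}$ the non-tangential limit below exists and $$\boldsymbol{\mu}^\alpha\{\lambda\}=\lim_{z\to\lambda\ \text{n.t.}}(1-z\bar\lambda)(I_n-b(z)\alpha^* )^{-1}.$$
   Context: $\mathbb{D}$ is the open unit disc and $\mathbb{T}=\partial\mathbb{D}$. $\mathscr{S}(n)$ is the set of bounded analytic $n\times n$ matrix-valued functions $b$ on $\mathbb{D}$ with $\|b(z)\|<1$ (operator norm) for all $z\in\mathbb{D}$. $\mathcal{U}(n)$ is the group of unitary $n\times n$ matrices. For $b\in\mathscr{S}(n)$ and $\alpha\in\mathcal{U}(n)$, the Aleksandrov--Clark measure $\boldsymbol{\mu}^\alpha$ is the unique finite non-negative $\mathbb{C}^{n\times n}$-valued Borel measure on $\mathbb{T}$ such that, with $H_\alpha(z)=(I_n+b(z)\alpha^* )(I_n-b(z)\alpha^* )^{-1}$, $$H_\alpha(z)=i\,\mathrm{Im}\,H_\alpha(0)+\int_{\mathbb{T}}\frac{\zeta+z}{\zeta-z}\,\boldsymbol{\mu}^\alpha(\mathrm{d}\zeta),\qquad z\in\mathbb{D},$$ where $\mathrm{Im}\,A=(A-A^* )/(2i)$. We write $\boldsymbol{\mu}^\alpha\{\lambda\}=\boldsymbol{\mu}^\alpha(\{\lambda\})$. The non-tangential ("n.t.") limit $z\to\lambda$ means the limit from within every Stolz region $\Gamma_t(\lambda)=\{z\in\mathbb{D}:|z-\lambda|<t(1-|z|)\}$, $t>1$.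 *)

theory Defs
  imports "HOL-Analysis.Analysis"
begin

definition cscale :: "complex \<Rightarrow> complex^'n^'m \<Rightarrow> complex^'n^'m"  (infixr "*\<^sub>C" 75)
  where "c *\<^sub>C A = (\<chi> i j. c * A $ i $ j)"

definition hconj :: "complex^'n^'m \<Rightarrow> complex^'m^'n"  ("_\<^sup>\<dagger>" [1000] 999)
  where "A\<^sup>\<dagger> = (\<chi> i j. cnj (A $ j $ i))"

definition mat_Im :: "complex^'n^'n \<Rightarrow> complex^'n^'n"
  where "mat_Im A = (1 / (2 * \<i>)) *\<^sub>C (A - A\<^sup>\<dagger>)"

definition unitary_matrices :: "(complex^'n^'n) set"
  where "unitary_matrices = {U. U ** U\<^sup>\<dagger> = mat 1 \<and> U\<^sup>\<dagger> ** U = mat 1}"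

text \<open>The norm of the type \<open>complex^'n\<close> is the Euclidean one, so \<open>onorm\<close> below is the operator
  norm; \<open>norm\<close> on matrices would be the Frobenius norm.\<close>

definition schur_class :: "(complex \<Rightarrow> complex^'n^'n) set"
  where "schur_class = {b.
    (\<forall>i j. (\<lambda>z. b z $ i $ j) holomorphic_on ball 0 1) \<and>
    bounded (b ` ball 0 1) \<and>
    (\<forall>z\<in>ball 0 1. onorm (\<lambda>v. b z *v v) < 1)}"

definition qform :: "complex^'n^'n \<Rightarrow> complex^'n \<Rightarrow> complex"
  where "qform A v = (\<Sum>i\<in>UNIV. (A *v v) $ i * cnj (v $ i))"

definition nonneg_matrix :: "complex^'n^'n \<Rightarrow> bool"
  where "nonneg_matrix A \<longleftrightarrow> (\<forall>v. qform A v \<in> \<real>\<^sub>\<ge>\<^sub>0)"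

text \<open>A matrix-valued measure is a countably additive set function on the sigma-algebra of \<open>M\<close>
  (only \<open>space M\<close> and \<open>sets M\<close> matter). Finiteness is built in, as the values are matrices with
  complex entries.\<close>

definition nonneg_matrix_measure :: "'a measure \<Rightarrow> ('a set \<Rightarrow> complex^'n^'n) \<Rightarrow> bool"
  where "nonneg_matrix_measure M \<mu> \<longleftrightarrow>
    (\<forall>E\<in>sets M. nonneg_matrix (\<mu> E)) \<and>
    (\<forall>A :: nat \<Rightarrow> 'a set. range A \<subseteq> sets M \<longrightarrow> disjoint_family A \<longrightarrow>
       (\<lambda>k. \<mu> (A k)) sums \<mu> (\<Union>k. A k))"

text \<open>The finite positive measure \<open>E \<mapsto> \<langle>\<mu>(E)v, v\<rangle>\<close>.\<close>

definition qform_measure :: "'a measure \<Rightarrow> ('a set \<Rightarrow> complex^'n^'n) \<Rightarrow> complex^'n \<Rightarrow> 'a measure"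
  where "qform_measure M \<mu> v =
    measure_of (space M) (sets M) (\<lambda>E. ennreal (Re (qform (\<mu> E) v)))"

text \<open>\<open>J = \<integral> f d\<mu>\<close> for scalar \<open>f\<close>, in the weak sense: \<open>\<langle>J v, v\<rangle> = \<integral> f d\<langle>\<mu>v, v\<rangle>\<close> for all
  \<open>v\<close>. By complex polarization this determines \<open>J\<close> and is the same as integrating \<open>f\<close> against
  every entry of \<open>\<mu>\<close>.\<close>

definition has_matrix_integral ::
    "'a measure \<Rightarrow> ('a set \<Rightarrow> complex^'n^'n) \<Rightarrow> ('a \<Rightarrow> complex) \<Rightarrow> complex^'n^'n \<Rightarrow> bool"
  where "has_matrix_integral M \<mu> f J \<longleftrightarrow>
    (\<forall>v. integrable (qform_measure M \<mu> v) f \<and>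
         qform J v = (LINT x|qform_measure M \<mu> v. f x))"

abbreviation circle_borel :: "complex measure"
  where "circle_borel \<equiv> restrict_space borel (sphere 0 1)"

definition herglotz_fun ::
    "(complex \<Rightarrow> complex^'n^'n) \<Rightarrow> complex^'n^'n \<Rightarrow> complex \<Rightarrow> complex^'n^'n"
  where "herglotz_fun b \<alpha> z =
    (mat 1 + b z ** \<alpha>\<^sup>\<dagger>) ** matrix_inv (mat 1 - b z ** \<alpha>\<^sup>\<dagger>)"

text \<open>\<open>\<mu>\<close> is the Aleksandrov--Clark measure of \<open>b\<close> and \<open>\<alpha>\<close>. The values of \<open>\<mu>\<close> on sets that are
  not Borel subsets of the circle are irrelevant.\<close>

definition is_AC_measure ::
    "(complex \<Rightarrow> complex^'n^'n) \<Rightarrow> complex^'n^'n \<Rightarrow> (complex set \<Rightarrow> complex^'n^'n) \<Rightarrow> bool"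
  where "is_AC_measure b \<alpha> \<mu> \<longleftrightarrow>
    nonneg_matrix_measure circle_borel \<mu> \<and>
    (\<forall>z\<in>ball 0 1. \<exists>J.
       has_matrix_integral circle_borel \<mu> (\<lambda>\<zeta>. (\<zeta> + z) / (\<zeta> - z)) J \<and>
       herglotz_fun b \<alpha> z = \<i> *\<^sub>C mat_Im (herglotz_fun b \<alpha> 0) + J)"

definition stolz_region :: "real \<Rightarrow> complex \<Rightarrow> complex set"
  where "stolz_region t \<xi> = {z \<in> ball 0 1. norm (z - \<xi>) < t * (1 - norm z)}"

definition has_nt_limit ::
    "(complex \<Rightarrow> 'a::topological_space) \<Rightarrow> 'a \<Rightarrow> complex \<Rightarrow> bool"
  where "has_nt_limit f L \<xi> \<longleftrightarrow>
    (\<forall>t>1. (f \<longlongrightarrow> L) (at \<xi> within stolz_region t \<xi>))"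

end

theory Submission
  imports Defs
begin

text \<open>Since \<open>(I - B)\<^sup>-\<^sup>1 = (I + H) / 2\<close> for the Herglotz function \<open>H\<close> of \<open>B = b \<alpha>\<^sup>*\<close>, the claim reduces to
  the limit of \<open>(1 - z \<xi>\<^sup>*) / 2\<close> times the Herglotz integral. Its integrand is bounded by \<open>t\<close> on the
  Stolz region with parameter \<open>t\<close> and converges pointwise to the indicator function of \<open>{\<xi>}\<close>, so
  dominated convergence applies to each measure \<open>\<langle>\<mu>v, v\<rangle>\<close>, and polarization recovers the matrix
  limit.\<close>

section \<open>Quadratic forms and polarization\<close>

lemma qform_add: "qform (A + B) v = qform A v + qform B v"
  by (simp add: qform_def matrix_vector_mult_add_rdistrib sum.distrib algebra_simps)

lemma qform_cscale: "qform (c *\<^sub>C A) v = c * qform A v"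
  by (simp add: qform_def cscale_def matrix_vector_mult_def sum_distrib_left sum_distrib_right
      mult.assoc)

text \<open>Weight \<open>qform A (u + c *s w)\<close> by \<open>c\<close> and sum over the fourth
  roots of unity: the sums of \<open>c\<close> and of \<open>c^2\<close> vanish, so only the term
  with factor \<open>c * cnj c = 1\<close> survives, four times.\<close>

lemma qform_polarization:
  fixes A :: "complex^'n^'n"
  shows "4 * A $ i $ j =
    qform A (axis j 1 + axis i 1) - qform A (axis j 1 + (-1) *s axis i 1)
    + \<i> * qform A (axis j 1 + \<i> *s axis i 1) - \<i> * qform A (axis j 1 + (-\<i>) *s axis i 1)"
proof -
  define S where "S u w = (\<Sum>k\<in>UNIV. (A *v u) $ k * cnj (w $ k))" for u w
  have expand: "qform A (u + c *s w) = S u u + cnj c * S u w + c * S w u + c * cnj c * S w w"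
    for u w c
    by (simp add: qform_def S_def matrix_vector_right_distrib vector_scalar_commute sum.distrib
        sum_distrib_left algebra_simps)
  have S_axis: "S (axis j 1) (axis i 1) = A $ i $ j"
  proof -
    have "S (axis j 1) (axis i 1) = (\<Sum>k\<in>UNIV. if k = i then A $ k $ j else 0)"
      unfolding S_def by (intro sum.cong)
        (auto simp: axis_def matrix_vector_mult_def if_distrib cong: if_cong)
    then show ?thesis by simp
  qed
  have plus: "axis j 1 + axis i 1 = axis j 1 + 1 *s (axis i 1 :: complex^'n)"
    by simp
  show ?thesis
    unfolding plus expand S_axis by (simp add: algebra_simps)
qed

text \<open>By polarization each entry is a fixed linear combination of four values of
  \<open>qform\<close>, so convergence can be tested one vector at a time.\<close>

lemma tendsto_qform_imp_tendsto:
  fixes f :: "'a \<Rightarrow> complex^'n^'n"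
  assumes "\<And>v. ((\<lambda>x. qform (f x) v) \<longlongrightarrow> qform L v) F"
  shows "(f \<longlongrightarrow> L) F"
proof (intro vec_tendstoI)
  fix i j
  have "((\<lambda>x. 4 * f x $ i $ j) \<longlongrightarrow> 4 * L $ i $ j) F"
    unfolding qform_polarization by (intro tendsto_intros assms)
  then show "((\<lambda>x. f x $ i $ j) \<longlongrightarrow> L $ i $ j) F"
    using tendsto_mult[OF tendsto_const[of "1/4"]] by fastforce
qed

lemma nonneg_matrix_qform:
  assumes "nonneg_matrix A"
  shows "Re (qform A v) \<ge> 0" "complex_of_real (Re (qform A v)) = qform A v"
  using assms unfolding nonneg_matrix_def nonneg_Reals_def by (fastforce dest: spec[of _ v])+

lemma bounded_linear_qform: "bounded_linear (\<lambda>A :: complex^'n^'n. qform A v)"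
  unfolding qform_def matrix_vector_mult_def
  by (simp, intro bounded_linear_sum bounded_linear_mult_const
      bounded_linear_compose[OF bounded_linear_vec_nth bounded_linear_vec_nth])

section \<open>Scalar measures attached to a matrix measure\<close>

lemma space_qform_measure [simp]: "space (qform_measure M \<mu> v) = space M"
  by (simp add: qform_measure_def space_measure_of_conv)

lemma sets_qform_measure [simp, measurable_cong]: "sets (qform_measure M \<mu> v) = sets M"
  by (simp add: qform_measure_def)

text \<open>\<open>measure_of\<close> reproduces the prescribed values once they vanish on the empty
  set and are countably additive. Additivity passes from \<mu> to the form because
  \<open>qform\<close> is bounded linear in the matrix; nonnegativity lets \<open>ennreal\<close>
  commute with the series.\<close>

lemma emeasure_qform_measure:
  assumes \<mu>: "nonneg_matrix_measure M \<mu>" and E: "E \<in> sets M"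
  shows "emeasure (qform_measure M \<mu> v) E = ennreal (Re (qform (\<mu> E) v))"
proof -
  have nonneg: "Re (qform (\<mu> E) v) \<ge> 0" if "E \<in> sets M" for E
    using \<mu> that by (simp add: nonneg_matrix_measure_def nonneg_matrix_qform)
  have sums: "(\<lambda>k. \<mu> (A k)) sums \<mu> (\<Union>k. A k)"
    if "range A \<subseteq> sets M" "disjoint_family A" for A :: "nat \<Rightarrow> _"
    using \<mu> that by (auto simp: nonneg_matrix_measure_def)
  \<comment> \<open>Additivity along the constant sequence of empty sets makes a constant series
    converge, which forces its term to be zero.\<close>
  have "(\<lambda>k::nat. \<mu> {}) sums \<mu> (\<Union>k::nat. {})"
    by (rule sums) (auto simp: disjoint_family_on_def)
  then have empty: "\<mu> {} = 0"
    using summable_const_iff sums_summable by blast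
  show ?thesis
    unfolding qform_measure_def
  proof (rule emeasure_measure_of_sigma[OF sets.sigma_algebra_axioms _ _ E])
    show "positive (sets M) (\<lambda>E. ennreal (Re (qform (\<mu> E) v)))"
      using empty by (simp add: positive_def qform_def)
    show "countably_additive (sets M) (\<lambda>E. ennreal (Re (qform (\<mu> E) v)))"
    proof (rule countably_additiveI)
      fix A :: "nat \<Rightarrow> _"
      assume A: "range A \<subseteq> sets M" "disjoint_family A"
      have "(\<lambda>k. Re (qform (\<mu> (A k)) v)) sums Re (qform (\<mu> (\<Union>k. A k)) v)"
        by (intro sums_Re bounded_linear.sums[OF bounded_linear_qform] sums A)
      then show "(\<Sum>k. ennreal (Re (qform (\<mu> (A k)) v))) = ennreal (Re (qform (\<mu> (\<Union>k. A k)) v))"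
        using A nonneg by (intro suminf_ennreal_eq) auto
    qed
  qed
qed

lemma finite_measure_qform_measure:
  assumes "nonneg_matrix_measure M \<mu>"
  shows "finite_measure (qform_measure M \<mu> v)"
  by (rule finite_measureI) (simp add: emeasure_qform_measure[OF assms])

section \<open>Invertibility and the resolvent\<close>

text \<open>Moving the adjoint across the inner product turns the squared norm of
  \<open>\<alpha>\<^sup>\<dagger> *v v\<close> into the pairing of \<open>v\<close> with
  \<open>\<alpha> *v (\<alpha>\<^sup>\<dagger> *v v) = v\<close>.\<close>

lemma norm_hconj_unitary:
  assumes "\<alpha> \<in> unitary_matrices"
  shows "norm (\<alpha>\<^sup>\<dagger> *v v) = norm v"
proof -
  have adj: "(\<Sum>i\<in>UNIV. (\<alpha>\<^sup>\<dagger> *v v) $ i * cnj (w $ i)) = (\<Sum>i\<in>UNIV. v $ i * cnj ((\<alpha> *v w) $ i))" for w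
    unfolding matrix_vector_mult_def hconj_def
    by (simp add: sum_distrib_left sum_distrib_right) (subst sum.swap, simp add: ac_simps)
  have norm_sq: "complex_of_real ((norm u)\<^sup>2) = (\<Sum>i\<in>UNIV. u $ i * cnj (u $ i))" for u :: "complex^'a"
    by (simp add: norm_vec_def L2_set_def sum_nonneg complex_norm_square flip: of_real_power)
  have "\<alpha> *v (\<alpha>\<^sup>\<dagger> *v v) = v"
    using assms by (simp add: unitary_matrices_def matrix_vector_mul_assoc)
  then have "complex_of_real ((norm (\<alpha>\<^sup>\<dagger> *v v))\<^sup>2) = complex_of_real ((norm v)\<^sup>2)"
    unfolding norm_sq adj by simp
  then show ?thesis
    by (simp only: of_real_eq_iff) simp
qed

text \<open>A nonzero kernel vector \<open>v\<close> would equal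
  \<open>C *v (\<alpha>\<^sup>\<dagger> *v v)\<close>, whose norm is strictly below
  \<open>norm v\<close> because the adjoint is isometric. For a square matrix a trivial kernel
  suffices.\<close>

lemma invertible_one_minus_contraction:
  assumes "onorm (\<lambda>v. C *v v) < 1" "\<alpha> \<in> unitary_matrices"
  shows "invertible (mat 1 - C ** \<alpha>\<^sup>\<dagger> :: complex^'n^'n)"
proof -
  have lin: "bounded_linear (\<lambda>v. C *v v)"
    by (intro linear_conv_bounded_linear[THEN iffD1] linearI, simp add: matrix_vector_right_distrib)
      (simp add: vec_eq_iff matrix_vector_mult_def scaleR_sum_right)
  have "v = 0" if "(mat 1 - C ** \<alpha>\<^sup>\<dagger>) *v v = 0" for v
  proof (rule ccontr)
    assume "v \<noteq> 0"
    from that have "v = C *v (\<alpha>\<^sup>\<dagger> *v v)"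
      by (simp add: matrix_vector_mult_diff_rdistrib matrix_vector_mul_assoc)
    then have "norm v \<le> onorm (\<lambda>v. C *v v) * norm v"
      using onorm[OF lin, of "\<alpha>\<^sup>\<dagger> *v v"] norm_hconj_unitary[OF assms(2)] by metis
    with \<open>v \<noteq> 0\<close> assms(1) show False by simp
  qed
  then show ?thesis
    by (simp add: invertible_left_inverse matrix_left_invertible_ker)
qed

lemma matrix_inv_right:
  assumes "invertible A"
  shows "A ** matrix_inv A = mat 1"
  using someI_ex[OF assms[unfolded invertible_def]] by (simp add: matrix_inv_def)

lemma matrix_matrix_mult_add_rdistrib:
  fixes A B :: "'a::semiring_1^'n^'m"
  shows "(A + B) ** C = A ** C + B ** C"
  by (simp add: vec_eq_iff matrix_matrix_mult_def sum.distrib distrib_right)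

text \<open>Writing \<open>mat 1\<close> as \<open>(mat 1 - ?B) ** ?R\<close> puts both summands
  over the common right factor \<open>?R\<close>, where \<open>?B\<close> cancels and
  \<open>2\<close> remains.\<close>

lemma matrix_inv_eq_herglotz_fun:
  assumes "invertible (mat 1 - b z ** \<alpha>\<^sup>\<dagger>)"
  shows "matrix_inv (mat 1 - b z ** \<alpha>\<^sup>\<dagger>) = (1/2) *\<^sub>C (mat 1 + herglotz_fun b \<alpha> z)"
proof -
  let ?B = "b z ** \<alpha>\<^sup>\<dagger>" and ?R = "matrix_inv (mat 1 - b z ** \<alpha>\<^sup>\<dagger>)"
  have "mat 1 + herglotz_fun b \<alpha> z = (mat 1 - ?B) ** ?R + (mat 1 + ?B) ** ?R"
    by (simp add: herglotz_fun_def matrix_inv_right[OF assms])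
  also have "\<dots> = ((mat 1 - ?B) + (mat 1 + ?B)) ** ?R"
    by (rule matrix_matrix_mult_add_rdistrib[symmetric])
  also have "\<dots> = (mat 1 + mat 1) ** ?R" by simp
  also have "\<dots> = ?R + ?R" by (simp only: matrix_matrix_mult_add_rdistrib matrix_mul_lid)
  finally show ?thesis by (simp add: cscale_def vec_eq_iff)
qed

section \<open>The Herglotz kernel near a boundary point\<close>

text \<open>The first factor has modulus \<open>norm (z - \<xi>) / 2\<close>, the Stolz condition
  bounds \<open>norm (z - \<xi>)\<close> by \<open>t * (1 - norm z)\<close>, and no \<zeta> on the
  circle is closer to \<open>z\<close> than \<open>1 - norm z\<close>. The numerator \<zeta> + z, of
  modulus at most 2, absorbs the factor 1/2.\<close>

lemma herglotz_kernel_bound: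
  assumes z: "z \<in> stolz_region t \<xi>" and \<xi>: "norm \<xi> = 1" and \<zeta>: "norm \<zeta> = 1"
  shows "norm ((1 - z * cnj \<xi>) / 2 * ((\<zeta> + z) / (\<zeta> - z))) \<le> t"
proof -
  have lt: "norm z < 1" and st: "norm (z - \<xi>) < t * (1 - norm z)"
    using z by (auto simp: stolz_region_def)
  \<comment> \<open>A point in the region forces this: a norm lies strictly below \<open>t\<close>
    times a positive number.\<close>
  have "t > 0"
    using st lt norm_ge_zero[of "z - \<xi>"] by (smt (verit) mult_nonpos_nonneg)
  have gap: "1 - norm z \<le> norm (\<zeta> - z)"
    using norm_triangle_ineq2[of \<zeta> z] \<zeta> by simp
  have "1 - z * cnj \<xi> = cnj \<xi> * (\<xi> - z)"
    using \<xi> by (simp add: algebra_simps complex_norm_square[symmetric])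
  then have "norm (1 - z * cnj \<xi>) = norm (z - \<xi>)"
    using \<xi> by (simp add: norm_mult norm_minus_commute)
  also have "\<dots> \<le> t * norm (\<zeta> - z)"
    using st mult_left_mono[OF gap, of t] \<open>t > 0\<close> by linarith
  finally have num: "norm (1 - z * cnj \<xi>) \<le> t * norm (\<zeta> - z)" .
  have "norm (\<zeta> + z) \<le> 2"
    using norm_triangle_ineq[of \<zeta> z] \<zeta> lt by linarith
  then have "norm (1 - z * cnj \<xi>) * norm (\<zeta> + z) \<le> (t * norm (\<zeta> - z)) * 2"
    using num \<open>t > 0\<close> by (intro mult_mono) auto
  moreover have "norm (\<zeta> - z) > 0"
    using gap lt by linarith
  ultimately have "norm (1 - z * cnj \<xi>) * norm (\<zeta> + z) / (2 * norm (\<zeta> - z)) \<le> t"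
    by (simp add: pos_divide_le_eq)
  then show ?thesis
    by (simp only: norm_mult norm_divide norm_numeral times_divide_times_eq)
qed

text \<open>At \<zeta> = \<xi> the zero of
  \<open>1 - z * cnj \<xi> = cnj \<xi> * (\<xi> - z)\<close> cancels the pole and leaves
  \<open>cnj \<xi> * (\<xi> + z) / 2\<close>. For any other \<zeta> the quotient is continuous at
  \<xi> and the first factor tends to zero.\<close>

lemma herglotz_kernel_tendsto:
  assumes \<xi>: "norm \<xi> = 1"
  shows "((\<lambda>z. (1 - z * cnj \<xi>) / 2 * ((\<zeta> + z) / (\<zeta> - z))) \<longlongrightarrow> indicator {\<xi>} \<zeta>) (at \<xi> within S)"
proof (cases "\<zeta> = \<xi>")
  case True
  have one: "\<xi> * cnj \<xi> = 1"
    using \<xi> by (simp add: complex_norm_square[symmetric])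
  have "((\<lambda>z. cnj \<xi> * (\<xi> + z) / 2) \<longlongrightarrow> cnj \<xi> * (\<xi> + \<xi>) / 2) (at \<xi> within S)"
    by (intro tendsto_intros) simp
  moreover have "cnj \<xi> * (\<xi> + \<xi>) / 2 = 1"
    using one by (simp add: algebra_simps)
  \<comment> \<open>This fails at z = \<xi>, where the right side is 0 and the left side is 1; the
    punctured filter excludes that point.\<close>
  moreover have "cnj \<xi> * (\<xi> + z) / 2 = (1 - z * cnj \<xi>) / 2 * ((\<zeta> + z) / (\<zeta> - z))" if "z \<noteq> \<xi>" for z
  proof -
    have "1 - z * cnj \<xi> = cnj \<xi> * (\<xi> - z)"
      using one by (simp add: algebra_simps)
    then have "(1 - z * cnj \<xi>) / (\<xi> - z) = cnj \<xi>"
      using that by simp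
    then have "cnj \<xi> * (\<xi> + z) / 2 = (1 - z * cnj \<xi>) / (\<xi> - z) * (\<xi> + z) / 2"
      by simp
    then show ?thesis using True
      by (simp only: times_divide_eq_left times_divide_eq_right divide_divide_eq_left ac_simps)
  qed
  ultimately show ?thesis
    using True by (auto elim!: Lim_transform_eventually simp: eventually_at_filter)
next
  case False
  then have "((\<lambda>z. (1 - z * cnj \<xi>) / 2 * ((\<zeta> + z) / (\<zeta> - z)))
      \<longlongrightarrow> (1 - \<xi> * cnj \<xi>) / 2 * ((\<zeta> + \<xi>) / (\<zeta> - \<xi>))) (at \<xi> within S)"
    by (intro tendsto_intros) auto
  then show ?thesis
    using False \<xi> by (simp add: complex_norm_square[symmetric])
qed

lemma tendsto_herglotz_integral:
  fixes M :: "complex measure"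
  assumes "finite_measure M" and sets_M: "sets M = sets circle_borel" and \<xi>: "norm \<xi> = 1"
  shows "((\<lambda>z. (1 - z * cnj \<xi>) / 2 * (LINT \<zeta>|M. (\<zeta> + z) / (\<zeta> - z))) \<longlongrightarrow> measure M {\<xi>})
    (at \<xi> within stolz_region t \<xi>)"
proof -
  interpret finite_measure M by fact
  have space_M: "space M = sphere 0 1"
    using sets_eq_imp_space_eq[OF sets_M] by (simp add: space_restrict_space)
  have single: "{\<xi>} \<in> sets M"
    using \<xi> by (auto simp: sets_M sets_restrict_space_iff)
  have kernel_measurable: "(\<lambda>\<zeta>. (1 - z * cnj \<xi>) / 2 * ((\<zeta> + z) / (\<zeta> - z))) \<in> borel_measurable M" for z
    unfolding measurable_cong_sets[OF sets_M refl] by (intro measurable_restrict_space1) measurable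
  have "((\<lambda>z. LINT \<zeta>|M. (1 - z * cnj \<xi>) / 2 * ((\<zeta> + z) / (\<zeta> - z)))
      \<longlongrightarrow> (LINT \<zeta>|M. indicator {\<xi>} \<zeta>)) (at \<xi> within stolz_region t \<xi>)"
    \<comment> \<open>Dominated convergence is stated for sequences, so the limit is tested along
      sequences in the region; the constant \<open>t\<close> is integrable because \<open>M\<close>
      is finite.\<close>
    unfolding tendsto_at_iff_sequentially comp_def
  proof (intro allI impI)
    fix X :: "nat \<Rightarrow> complex"
    assume X: "\<forall>i. X i \<in> stolz_region t \<xi> - {\<xi>}" and lim: "X \<longlonglongrightarrow> \<xi>"
    show "(\<lambda>i. LINT \<zeta>|M. (1 - X i * cnj \<xi>) / 2 * ((\<zeta> + X i) / (\<zeta> - X i)))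
        \<longlonglongrightarrow> (LINT \<zeta>|M. indicator {\<xi>} \<zeta>)"
    proof (rule integral_dominated_convergence[where w = "\<lambda>_. t"])
      show "(indicator {\<xi>} :: complex \<Rightarrow> complex) \<in> borel_measurable M"
        using single by (rule borel_measurable_indicator)
      show "AE \<zeta> in M. (\<lambda>i. (1 - X i * cnj \<xi>) / 2 * ((\<zeta> + X i) / (\<zeta> - X i)))
          \<longlonglongrightarrow> indicator {\<xi>} \<zeta>"
      proof (rule AE_I2)
        fix \<zeta>
        from herglotz_kernel_tendsto[OF \<xi>, of \<zeta> "stolz_region t \<xi>"] X lim
        show "(\<lambda>i. (1 - X i * cnj \<xi>) / 2 * ((\<zeta> + X i) / (\<zeta> - X i))) \<longlonglongrightarrow> indicator {\<xi>} \<zeta>"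
          by (simp add: tendsto_at_iff_sequentially comp_def)
      qed
      show "AE \<zeta> in M. norm ((1 - X i * cnj \<xi>) / 2 * ((\<zeta> + X i) / (\<zeta> - X i))) \<le> t" for i
        using X \<xi> by (intro AE_I2 herglotz_kernel_bound) (auto simp: space_M)
      show "(\<lambda>\<zeta>. (1 - X i * cnj \<xi>) / 2 * ((\<zeta> + X i) / (\<zeta> - X i))) \<in> borel_measurable M" for i
        by (rule kernel_measurable)
    qed simp
  qed
  moreover have "(LINT \<zeta>|M. indicator {\<xi>} \<zeta>) = complex_of_real (measure M {\<xi>})"
  proof -
    \<comment> \<open>The complex indicator is recast as a real one scaling \<open>1\<close>, the
      form in which the Bochner integral of an indicator is known.\<close>
    have "(LINT \<zeta>|M. indicator {\<xi>} \<zeta>) = (LINT \<zeta>|M. indicator {\<xi>} \<zeta> *\<^sub>R (1 :: complex))"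
      by (intro Bochner_Integration.integral_cong) (auto simp: indicator_def)
    then show ?thesis
      using has_bochner_integral_integral_eq[OF has_bochner_integral_indicator[OF single, of 1]]
      by (simp add: of_real_def emeasure_eq_measure)
  qed
  ultimately show ?thesis
    by (simp only: integral_mult_right_zero)
qed

section \<open>The point mass as a non-tangential limit\<close>

theorem theorem3p1:
  fixes b :: "complex \<Rightarrow> complex^'n^'n"
    and \<alpha> :: "complex^'n^'n"
    and \<mu> :: "complex set \<Rightarrow> complex^'n^'n"
    and \<xi> :: complex
  assumes "b \<in> schur_class"
    and "\<alpha> \<in> unitary_matrices"
    and "is_AC_measure b \<alpha> \<mu>"
    and "\<xi> \<in> sphere 0 1"
  shows "has_nt_limit
    (\<lambda>z. (1 - z * cnj \<xi>) *\<^sub>C matrix_inv (mat 1 - b z ** \<alpha>\<^sup>\<dagger>)) (\<mu> {\<xi>}) \<xi>"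
  unfolding has_nt_limit_def
proof (intro allI impI tendsto_qform_imp_tendsto)
  fix t :: real and v :: "complex^'n"
  let ?F = "at \<xi> within stolz_region t \<xi>"
  let ?M = "qform_measure circle_borel \<mu> v"
  let ?K = "\<i> *\<^sub>C mat_Im (herglotz_fun b \<alpha> 0)"
  have \<xi>: "norm \<xi> = 1"
    using assms(4) by simp
  have \<mu>: "nonneg_matrix_measure circle_borel \<mu>"
    using assms(3) by (simp add: is_AC_measure_def)
  have single: "{\<xi>} \<in> sets circle_borel"
    using \<xi> by (auto simp: sets_restrict_space_iff)
  have nonneg: "nonneg_matrix (\<mu> {\<xi>})"
    using \<mu> single by (simp add: nonneg_matrix_measure_def)
  \<comment> \<open>Nonnegativity is used twice: the form equals its real part, and
    \<open>ennreal\<close> does not truncate it.\<close>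
  have point_mass: "complex_of_real (measure ?M {\<xi>}) = qform (\<mu> {\<xi>}) v"
    using emeasure_qform_measure[OF \<mu> single, of v] nonneg_matrix_qform[OF nonneg]
    by (simp add: measure_def)
  \<comment> \<open>All of \<open>mat 1 + herglotz_fun b \<alpha> z\<close> except the integral is
    constant in \<open>z\<close>, so the vanishing prefactor removes it in the limit.\<close>
  have "((\<lambda>z. (1 - z * cnj \<xi>) / 2 * qform (mat 1 + ?K) v) \<longlongrightarrow>
      (1 - \<xi> * cnj \<xi>) / 2 * qform (mat 1 + ?K) v) ?F"
    by (intro tendsto_intros) simp
  moreover have "1 - \<xi> * cnj \<xi> = 0"
    using \<xi> by (simp add: complex_norm_square[symmetric])
  moreover have "((\<lambda>z. (1 - z * cnj \<xi>) / 2 * (LINT \<zeta>|?M. (\<zeta> + z) / (\<zeta> - z))) \<longlongrightarrow> qform (\<mu> {\<xi>}) v) ?F"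
    using tendsto_herglotz_integral[OF finite_measure_qform_measure[OF \<mu>] sets_qform_measure \<xi>, of v t]
    by (simp only: point_mass)
  ultimately have lim: "((\<lambda>z. (1 - z * cnj \<xi>) / 2 * qform (mat 1 + ?K) v
      + (1 - z * cnj \<xi>) / 2 * (LINT \<zeta>|?M. (\<zeta> + z) / (\<zeta> - z))) \<longlongrightarrow> qform (\<mu> {\<xi>}) v) ?F"
    using tendsto_add by fastforce
  have eq: "(1 - z * cnj \<xi>) / 2 * qform (mat 1 + ?K) v
      + (1 - z * cnj \<xi>) / 2 * (LINT \<zeta>|?M. (\<zeta> + z) / (\<zeta> - z))
      = qform ((1 - z * cnj \<xi>) *\<^sub>C matrix_inv (mat 1 - b z ** \<alpha>\<^sup>\<dagger>)) v"
    if z: "z \<in> stolz_region t \<xi>" for z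
  proof -
    have ball: "z \<in> ball 0 1"
      using z by (simp add: stolz_region_def)
    then have "invertible (mat 1 - b z ** \<alpha>\<^sup>\<dagger>)"
      using assms(1,2) by (intro invertible_one_minus_contraction) (auto simp: schur_class_def)
    note inv = matrix_inv_eq_herglotz_fun[of b z \<alpha>, OF this]
    from ball assms(3) obtain J where
      J: "has_matrix_integral circle_borel \<mu> (\<lambda>\<zeta>. (\<zeta> + z) / (\<zeta> - z)) J"
        "herglotz_fun b \<alpha> z = ?K + J"
      unfolding is_AC_measure_def by blast
    have "qform J v = (LINT \<zeta>|?M. (\<zeta> + z) / (\<zeta> - z))"
      using J(1) by (simp add: has_matrix_integral_def)
    then show ?thesis
      by (simp add: inv J(2) qform_cscale qform_add algebra_simps)
  qed
  show "((\<lambda>z. qform ((1 - z * cnj \<xi>) *\<^sub>C matrix_inv (mat 1 - b z ** \<alpha>\<^sup>\<dagger>)) v)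
      \<longlongrightarrow> qform (\<mu> {\<xi>}) v) ?F"
    \<comment> \<open>The identity \<open>eq\<close> holds on the Stolz region only, which is all
      that the filter \<open>?F\<close> sees.\<close>
    by (rule Lim_transform_eventually[OF lim])
      (use eq in \<open>auto simp: eventually_at_filter simp del: times_divide_eq_left\<close>)
qed

end
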